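(* Let $\mathbb{F}$ be a field with $\operatorname{char}(\mathbb{F})\neq 2$. Then $\mathbf{VNP}_1^{\mathrm{weak}}\subsetneq\mathbf{VNP}_1^{\mathrm{weak}+}=\mathbf{VNP}$.
   Context: A width-1 algebraic branching program computes a product of its edge labels. Let $\mathbb{S}$ be the set of affine linear forms $\alpha x_i+\beta$ ($\alpha,\beta\in\mathbb{F}$), and $\mathbb{S}^+=\{\alpha x_i+\beta x_j+\gamma\mid\alpha,\beta,\gamma\in\mathbb{F}\}$ the affine linear forms in at most two variables. $\mathbf{VP}_1^{\mathrm{weak}}$ (resp. $\mathbf{VP}_1^{\mathrm{weak}+}$) is the class of families (in polynomially many variables) $(f_n)$ such that $f_n$ is a product of polynomially many forms from $\mathbb{S}$ (resp. $\mathbb{S}^+$). For a class $\mathbf{C}$, $\mathrm{N}(\mathbf{C})$ consists of families $(f_n)$ for which there are $(g_n)\in\mathbf{C}$ and polynomially bounded $p,q$ with $f_n(\mathbf{x})=\sum_{\mathbf{b}\in\{0,1\}^{p(n)}}g_{q(n)}(\mathbf{b},\mathbf{x})$; $\mathbf{VNP}_1^{\mathrm{weak}}=\mathrm{N}(\mathbf{VP}_1^{\mathrm{weak}})$ and $\mathbf{VNP}_1^{\mathrm{weak}+}=\mathrm{N}(\mathbf{VP}_1^{\mathrm{weak}+})$. $\mathbf{VNP}$ is Valiant's class of p-definable families, equal to $\mathrm{N}(\mathbf{VP}_e)$ with $\mathbf{VP}_e$ the families of polynomially bounded arithmetic formula size. *)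

theory Defs
  imports "HOL-Library.Poly_Mapping" "HOL-Library.FuncSet"
    "HOL-Computational_Algebra.Computational_Algebra"
begin

text \<open>
  Polynomials over \<open>'a\<close> in the variables \<open>x\<^sub>0, x\<^sub>1, \<dots>\<close>, as finitely supported functions from
  monomials (finitely supported exponent vectors) to coefficients.
\<close>

type_synonym 'a mpoly = "(nat \<Rightarrow>\<^sub>0 nat) \<Rightarrow>\<^sub>0 'a"

definition Var :: "nat \<Rightarrow> 'a::field mpoly" where
  "Var i = Poly_Mapping.single (Poly_Mapping.single i 1) 1"

definition Const :: "'a \<Rightarrow> 'a::field mpoly" where
  "Const c = Poly_Mapping.single 0 c"

definition vars :: "'a::field mpoly \<Rightarrow> nat set" where
  "vars f = (\<Union>m\<in>Poly_Mapping.keys f. Poly_Mapping.keys m)"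

definition subst :: "(nat \<Rightarrow> 'a::field mpoly) \<Rightarrow> 'a mpoly \<Rightarrow> 'a mpoly" where
  "subst \<sigma> f = (\<Sum>m\<in>Poly_Mapping.keys f. Const (Poly_Mapping.lookup f m) *
      (\<Prod>i\<in>Poly_Mapping.keys m. \<sigma> i ^ Poly_Mapping.lookup m i))"

definition p_bounded :: "(nat \<Rightarrow> nat) \<Rightarrow> bool" where
  "p_bounded t \<longleftrightarrow> (\<exists>P :: nat poly. \<forall>n. t n \<le> poly P n)"

definition families :: "(nat \<Rightarrow> 'a::field mpoly) set" where
  "families = {f. p_bounded (\<lambda>n. card (vars (f n)))}"

definition affine_forms :: "'a::field mpoly set" where
  "affine_forms = {Const \<alpha> * Var i + Const \<beta> | \<alpha> \<beta> i. True}"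

definition affine_forms_plus :: "'a::field mpoly set" where
  "affine_forms_plus = {Const \<alpha> * Var i + Const \<beta> * Var j + Const \<gamma> | \<alpha> \<beta> \<gamma> i j. True}"

text \<open>
  Families computed by width-1 algebraic branching programs of polynomially bounded length
  with edge labels from \<open>L\<close>; the value of such a program is the product of its labels.
\<close>

definition VP1_over :: "'a::field mpoly set \<Rightarrow> (nat \<Rightarrow> 'a mpoly) set" where
  "VP1_over L = {f \<in> families. \<exists>s. p_bounded s \<and>
      (\<forall>n. \<exists>ls. length ls \<le> s n \<and> set ls \<subseteq> L \<and> f n = prod_list ls)}"

definition VP1_weak :: "(nat \<Rightarrow> 'a::field mpoly) set" where
  "VP1_weak = VP1_over affine_forms"

definition VP1_weak_plus :: "(nat \<Rightarrow> 'a::field mpoly) set" where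
  "VP1_weak_plus = VP1_over affine_forms_plus"

text \<open>
  \<open>g(b, x)\<close> with \<open>b\<close> of length \<open>p\<close>: the first \<open>p\<close> variables of \<open>g\<close> receive the
  values \<open>b\<close>, and the remaining ones are renamed to \<open>x\<^sub>0, x\<^sub>1, \<dots>\<close>.
\<close>

definition subst_bits :: "nat \<Rightarrow> (nat \<Rightarrow> 'a::field) \<Rightarrow> 'a mpoly \<Rightarrow> 'a mpoly" where
  "subst_bits p b g = subst (\<lambda>i. if i < p then Const (b i) else Var (i - p)) g"

definition hypercube :: "nat \<Rightarrow> (nat \<Rightarrow> 'a::field) set" where
  "hypercube p = {..<p} \<rightarrow>\<^sub>E {0, 1}"

definition hypercube_sums :: "(nat \<Rightarrow> 'a::field mpoly) set \<Rightarrow> (nat \<Rightarrow> 'a mpoly) set" where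
  "hypercube_sums C = {f \<in> families. \<exists>g\<in>C. \<exists>p q. p_bounded p \<and> p_bounded q \<and>
      (\<forall>n. f n = (\<Sum>b\<in>hypercube (p n). subst_bits (p n) b (g (q n))))}"

datatype 'a formula =
    FVar nat
  | FConst 'a
  | FAdd "'a formula" "'a formula"
  | FMul "'a formula" "'a formula"

primrec formula_poly :: "'a::field formula \<Rightarrow> 'a mpoly" where
  "formula_poly (FVar i) = Var i"
| "formula_poly (FConst c) = Const c"
| "formula_poly (FAdd \<phi> \<psi>) = formula_poly \<phi> + formula_poly \<psi>"
| "formula_poly (FMul \<phi> \<psi>) = formula_poly \<phi> * formula_poly \<psi>"

text \<open>The size counts all nodes of the tree, inputs included.\<close>

primrec formula_size :: "'a formula \<Rightarrow> nat" where
  "formula_size (FVar i) = 1"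
| "formula_size (FConst c) = 1"
| "formula_size (FAdd \<phi> \<psi>) = 1 + formula_size \<phi> + formula_size \<psi>"
| "formula_size (FMul \<phi> \<psi>) = 1 + formula_size \<phi> + formula_size \<psi>"

definition VP_e :: "(nat \<Rightarrow> 'a::field mpoly) set" where
  "VP_e = {f \<in> families. \<exists>s. p_bounded s \<and>
      (\<forall>n. \<exists>\<phi>. formula_size \<phi> \<le> s n \<and> formula_poly \<phi> = f n)}"

definition VNP1_weak :: "(nat \<Rightarrow> 'a::field mpoly) set" where
  "VNP1_weak = hypercube_sums VP1_weak"

definition VNP1_weak_plus :: "(nat \<Rightarrow> 'a::field mpoly) set" where
  "VNP1_weak_plus = hypercube_sums VP1_weak_plus"

text \<open>
  Valiant's p-definable families, with summands of polynomially bounded formula size; admitting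
  summands with circuits of polynomially bounded size and degree yields the same class.
\<close>

definition VNP :: "(nat \<Rightarrow> 'a::field mpoly) set" where
  "VNP = hypercube_sums VP_e"

end

theory Submission
  imports Defs
begin

text \<open>
  A product of univariate forms, and hence a hypercube sum of such products, has the shape
  \<open>u(x\<^sub>0) v(x\<^sub>1)\<close> in the variables \<open>x\<^sub>0, x\<^sub>1\<close>. The polynomial \<open>x\<^sub>0 + x\<^sub>1\<close> has not,
  because \<open>f(0,0) f(1,1) = f(1,0) f(0,1)\<close> fails for it; this gives the strict inclusion.

  For \<open>VNP \<subseteq> VNP1_weak_plus\<close> one constructs for every formula \<open>\<phi>\<close> a hypercube sum \<open>E\<close>
  of products of bivariate forms with an additional bit \<open>e\<close> such that \<open>E\<close> is \<open>1\<close> at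
  \<open>e = 0\<close> and \<open>\<phi>\<close> at \<open>e = 1\<close>. Products share the bit \<open>e\<close>. For a sum, two new bits with
  \<open>e = l + r\<close> choose a summand; this constraint, which couples three bits, is a signed sum over one
  more bit of 2-CNF clauses, and a clause is a product of bivariate forms when \<open>2\<close> is invertible.
\<close>

subsection \<open>Substitution as a ring homomorphism\<close>

definition monom_subst :: "(nat \<Rightarrow> 'a::field mpoly) \<Rightarrow> (nat \<Rightarrow>\<^sub>0 nat) \<Rightarrow> 'a mpoly" where
  "monom_subst \<sigma> m = (\<Prod>i\<in>Poly_Mapping.keys m. \<sigma> i ^ Poly_Mapping.lookup m i)"

text \<open>Factors outside the support have exponent 0. Enlarging the index set gives
  \<open>m\<close>, \<open>m'\<close> and \<open>m + m'\<close> a common one, on which exponents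
  add.\<close>

lemma monom_subst_superset:
  assumes "finite A" "Poly_Mapping.keys m \<subseteq> A"
  shows "monom_subst \<sigma> m = (\<Prod>i\<in>A. \<sigma> i ^ Poly_Mapping.lookup m i)"
  unfolding monom_subst_def
  by (rule prod.mono_neutral_left) (use assms in \<open>auto simp: in_keys_iff\<close>)

lemma monom_subst_add: "monom_subst \<sigma> (m + m') = monom_subst \<sigma> m * monom_subst \<sigma> m'"
proof -
  let ?A = "Poly_Mapping.keys m \<union> Poly_Mapping.keys m'"
  have "Poly_Mapping.keys (m + m') \<subseteq> ?A"
    by (rule Poly_Mapping.keys_add)
  then show ?thesis
    by (simp add: monom_subst_superset[of ?A] lookup_add power_add prod.distrib)
qed

lemma Const_0 [simp]: "Const 0 = 0"
  and Const_1 [simp]: "Const 1 = 1"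
  and Const_add: "Const (a + b) = Const a + Const b"
  and Const_mult: "Const (a * b) = Const a * Const b"
  by (simp_all add: Const_def single_add mult_single)

lemma Const_uminus [simp]: "Const (- a) = - Const a"
  by (simp add: Const_def single_uminus)

lemma Const_numeral [simp]: "Const (numeral w) = numeral w"
  by (simp add: Const_def)

lemma subst_superset:
  assumes "finite A" "Poly_Mapping.keys f \<subseteq> A"
  shows "subst \<sigma> f = (\<Sum>m\<in>A. Const (Poly_Mapping.lookup f m) * monom_subst \<sigma> m)"
  unfolding subst_def monom_subst_def
  by (rule sum.mono_neutral_left) (use assms in \<open>auto simp: in_keys_iff\<close>)

lemma subst_add [simp]: "subst \<sigma> (f + g) = subst \<sigma> f + subst \<sigma> g"
proof -
  let ?A = "Poly_Mapping.keys f \<union> Poly_Mapping.keys g"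
  have "Poly_Mapping.keys (f + g) \<subseteq> ?A"
    by (rule Poly_Mapping.keys_add)
  then show ?thesis
    by (simp add: subst_superset[of ?A] lookup_add Const_add distrib_right sum.distrib)
qed

lemma subst_single: "subst \<sigma> (Poly_Mapping.single m c) = Const c * monom_subst \<sigma> m"
  by (subst subst_superset[of "{m}"]) auto

lemma subst_Const [simp]: "subst \<sigma> (Const c) = Const c"
  by (simp add: Const_def[of c] subst_single) (simp add: monom_subst_def Const_def)

lemma subst_Var [simp]: "subst \<sigma> (Var i) = \<sigma> i"
  by (simp add: Var_def subst_single) (simp add: monom_subst_def)

lemma subst_0 [simp]: "subst \<sigma> 0 = 0"
  using subst_Const[of \<sigma> 0] by simp

lemma subst_1 [simp]: "subst \<sigma> 1 = 1"
  using subst_Const[of \<sigma> 1] by simp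

lemma subst_uminus [simp]: "subst \<sigma> (- f) = - subst \<sigma> f"
  using subst_add[of \<sigma> f "- f"] by (simp add: eq_neg_iff_add_eq_0 add.commute)

lemma subst_diff [simp]: "subst \<sigma> (f - g) = subst \<sigma> f - subst \<sigma> g"
  using subst_add[of \<sigma> f "- g"] by simp

lemma subst_sum: "subst \<sigma> (sum f A) = (\<Sum>x\<in>A. subst \<sigma> (f x))"
  by (induction A rule: infinite_finite_induct) auto

lemma poly_mapping_sum_single:
  "f = (\<Sum>m\<in>Poly_Mapping.keys f. Poly_Mapping.single m (Poly_Mapping.lookup f m))"
proof (rule poly_mapping_eqI)
  fix k
  show "Poly_Mapping.lookup f k = Poly_Mapping.lookup
      (\<Sum>m\<in>Poly_Mapping.keys f. Poly_Mapping.single m (Poly_Mapping.lookup f m)) k"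
    by (simp add: lookup_sum lookup_single when_def in_keys_iff)
qed

text \<open>Bilinearity reduces the claim to monomials, where it is \<open>monom_subst_add\<close>.
  The support of \<open>f * g\<close>, which cancellation may shrink, never has to be
  described.\<close>

lemma subst_mult [simp]: "subst \<sigma> (f * g) = subst \<sigma> f * subst \<sigma> g"
proof -
  let ?s = "\<lambda>f m. Poly_Mapping.single m (Poly_Mapping.lookup f m)"
  let ?K = Poly_Mapping.keys
  have "f * g = (\<Sum>m\<in>?K f. ?s f m) * (\<Sum>m\<in>?K g. ?s g m)"
    by (simp flip: poly_mapping_sum_single)
  also have "subst \<sigma> \<dots> = (\<Sum>m\<in>?K f. \<Sum>m'\<in>?K g. subst \<sigma> (?s f m) * subst \<sigma> (?s g m'))"
    by (simp add: sum_product subst_sum mult_single subst_single monom_subst_add Const_mult mult_ac)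
  also have "\<dots> = subst \<sigma> (\<Sum>m\<in>?K f. ?s f m) * subst \<sigma> (\<Sum>m\<in>?K g. ?s g m)"
    by (simp add: sum_product subst_sum)
  finally show ?thesis
    by (simp flip: poly_mapping_sum_single)
qed

lemma subst_power [simp]: "subst \<sigma> (f ^ k) = subst \<sigma> f ^ k"
  by (induction k) auto

lemma subst_prod: "subst \<sigma> (prod f A) = (\<Prod>x\<in>A. subst \<sigma> (f x))"
  by (induction A rule: infinite_finite_induct) auto

lemma subst_prod_list: "subst \<sigma> (prod_list fs) = prod_list (map (subst \<sigma>) fs)"
  by (induction fs) auto

text \<open>Reduces identities between iterated substitutions to a comparison of two assignments of
  the variables; the later proofs about \<open>subst_bits\<close> and \<open>plug\<close> rest on
  this.\<close>

lemma subst_subst: "subst \<sigma> (subst \<tau> f) = subst (\<lambda>i. subst \<sigma> (\<tau> i)) f"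
  by (simp add: subst_def[of \<tau>] subst_def[of "\<lambda>i. subst \<sigma> (\<tau> i)"] subst_sum subst_prod)

lemma subst_Var_id [simp]: "subst Var f = f"
proof -
  have "monom_subst Var m = Poly_Mapping.single m (1::'a)" for m
  proof -
    have pow: "Var i ^ k = Poly_Mapping.single (Poly_Mapping.single i k) (1::'a)" for i k
      by (induction k) (simp_all add: Var_def mult_single flip: single_add)
    have "(\<Prod>i\<in>A. Poly_Mapping.single (h i) (1::'a)) = Poly_Mapping.single (sum h A) 1"
      if "finite A" for A :: "nat set" and h :: "nat \<Rightarrow> nat \<Rightarrow>\<^sub>0 nat"
      using that by (induction A) (simp_all add: mult_single)
    then show ?thesis
      by (simp add: monom_subst_def pow flip: poly_mapping_sum_single)
  qed
  then have "subst Var f =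
      (\<Sum>m\<in>Poly_Mapping.keys f. Poly_Mapping.single m (Poly_Mapping.lookup f m))"
    by (simp add: subst_superset[of "Poly_Mapping.keys f"] Const_def mult_single)
  then show ?thesis
    by (simp flip: poly_mapping_sum_single)
qed

subsection \<open>Polynomially bounded functions\<close>

lemma p_bounded_mono: "p_bounded t \<Longrightarrow> (\<And>n. s n \<le> t n) \<Longrightarrow> p_bounded s"
  unfolding p_bounded_def by (meson order_trans)

lemma p_bounded_const: "p_bounded (\<lambda>_. c)"
  unfolding p_bounded_def by (intro exI[of _ "[:c:]"]) simp

lemma p_bounded_ident: "p_bounded (\<lambda>n. n)"
  unfolding p_bounded_def by (intro exI[of _ "[:0, 1:]"]) simp

lemma p_bounded_add:
  assumes "p_bounded s" "p_bounded t"
  shows "p_bounded (\<lambda>n. s n + t n)"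
proof -
  obtain P Q where "\<And>n. s n \<le> poly P n" "\<And>n. t n \<le> poly Q n"
    using assms by (auto simp: p_bounded_def)
  then show ?thesis
    unfolding p_bounded_def by (intro exI[of _ "P + Q"]) (simp add: add_mono)
qed

lemma p_bounded_cmult:
  assumes "p_bounded s"
  shows "p_bounded (\<lambda>n. c * s n)"
proof -
  obtain P where "\<And>n. s n \<le> poly P n"
    using assms by (auto simp: p_bounded_def)
  then show ?thesis
    unfolding p_bounded_def by (intro exI[of _ "smult c P"]) simp
qed

lemma poly_nat_mono: "poly P m \<le> poly P n" if "m \<le> n" for P :: "nat poly"
  using that by (induction P) (auto intro!: add_mono mult_mono)

text \<open>Polynomials with natural coefficients are monotone, so the bound on \<open>q\<close> may
  be inserted into the bound on \<open>s\<close>.\<close>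

lemma p_bounded_compose:
  assumes "p_bounded s" "p_bounded q"
  shows "p_bounded (\<lambda>n. s (q n))"
proof -
  obtain P Q where "\<And>n. s n \<le> poly P n" "\<And>n. q n \<le> poly Q n"
    using assms by (auto simp: p_bounded_def)
  then have "s (q n) \<le> poly P (poly Q n)" for n
    by (meson order_trans poly_nat_mono)
  then show ?thesis
    unfolding p_bounded_def by (intro exI[of _ "P \<circ>\<^sub>p Q"]) (simp add: poly_pcompose)
qed

subsection \<open>Variables of products of affine forms\<close>

lemma finite_vars: "finite (vars f)"
  by (simp add: vars_def)

lemma vars_add: "vars (f + g) \<subseteq> vars f \<union> vars g"
  using Poly_Mapping.keys_add[of f g] by (auto simp: vars_def)

lemma vars_mult: "vars (f * g) \<subseteq> vars f \<union> vars g"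
proof
  fix i assume "i \<in> vars (f * g)"
  then obtain m where m: "m \<in> Poly_Mapping.keys (f * g)" "i \<in> Poly_Mapping.keys m"
    by (auto simp: vars_def)
  then obtain a b where "m = a + b" "a \<in> Poly_Mapping.keys f" "b \<in> Poly_Mapping.keys g"
    using keys_mult[of f g] by blast
  then show "i \<in> vars f \<union> vars g"
    using m Poly_Mapping.keys_add[of a b] by (auto simp: vars_def)
qed

lemma vars_Const [simp]: "vars (Const c) = {}"
  by (simp add: vars_def Const_def)

lemma vars_1 [simp]: "vars 1 = {}"
  by (simp flip: Const_1)

lemma vars_Var [simp]: "vars (Var i) = {i}"
  by (simp add: vars_def Var_def)

lemma card_vars_affine_form_plus:
  assumes "l \<in> affine_forms_plus"
  shows "card (vars l) \<le> 2"
proof -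
  obtain \<alpha> \<beta> \<gamma> i j where l: "l = Const \<alpha> * Var i + Const \<beta> * Var j + Const \<gamma>"
    using assms by (auto simp: affine_forms_plus_def)
  have "vars l \<subseteq> {i, j}"
    unfolding l
    using vars_add[of "Const \<alpha> * Var i + Const \<beta> * Var j" "Const \<gamma>"]
      vars_add[of "Const \<alpha> * Var i" "Const \<beta> * Var j"]
      vars_mult[of "Const \<alpha>" "Var i"] vars_mult[of "Const \<beta>" "Var j"]
    by auto
  then have "card (vars l) \<le> card {i, j}"
    by (rule card_mono[rotated]) simp
  also have "\<dots> \<le> 2"
    by (simp add: card_insert_if)
  finally show ?thesis .
qed

text \<open>Supplies the bound on the number of variables that \<open>families\<close> demands of
  the summands.\<close>

lemma card_vars_prod_list:
  assumes "set ls \<subseteq> affine_forms_plus"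
  shows "card (vars (prod_list ls)) \<le> 2 * length ls"
  using assms
proof (induction ls)
  case Nil
  then show ?case
    by simp
next
  case (Cons l ls)
  have "card (vars (prod_list (l # ls))) \<le> card (vars l \<union> vars (prod_list ls))"
    by (rule card_mono) (use vars_mult in \<open>auto simp: finite_vars\<close>)
  also have "\<dots> \<le> card (vars l) + card (vars (prod_list ls))"
    by (rule card_Un_le)
  also have "\<dots> \<le> 2 + 2 * length ls"
    using Cons card_vars_affine_form_plus[of l] by (intro add_mono) auto
  finally show ?case
    by simp
qed

subsection \<open>Hypercube sums\<close>

lemma hypercube_sums_mono: "C \<subseteq> D \<Longrightarrow> hypercube_sums C \<subseteq> hypercube_sums D"
  unfolding hypercube_sums_def by blast

text \<open>The cube of dimension 0 has one point and substitutes nothing, so \<open>p = 0\<close>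
  and the identity as \<open>q\<close> suffice.\<close>

lemma subset_hypercube_sums: "C \<subseteq> families \<Longrightarrow> C \<subseteq> hypercube_sums C"
proof
  fix f assume "C \<subseteq> families" "f \<in> C"
  moreover have "f n = (\<Sum>b\<in>hypercube 0. subst_bits 0 b (f n))" for n
    by (simp add: hypercube_def subst_bits_def)
  ultimately show "f \<in> hypercube_sums C"
    unfolding hypercube_sums_def using p_bounded_const[of 0] p_bounded_ident by fast
qed

lemma bij_betw_hypercube_append:
  "bij_betw (\<lambda>(c, b) i. if i < k then c i else if i < k + p then b (i - k) else undefined)
    (hypercube k \<times> hypercube p) (hypercube (k + p) :: (nat \<Rightarrow> 'a::field) set)"
proof (rule bij_betwI[where g = "\<lambda>d. (restrict d {..<k}, restrict (\<lambda>i. d (i + k)) {..<p})"])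
  show "(\<lambda>(c, b) i. if i < k then c i else if i < k + p then b (i - k) else undefined)
      \<in> hypercube k \<times> hypercube p \<rightarrow> (hypercube (k + p) :: (nat \<Rightarrow> 'a) set)"
  proof safe
    fix c b :: "nat \<Rightarrow> 'a"
    assume "c \<in> hypercube k" "b \<in> hypercube p"
    then have "c i \<in> {0, 1}" if "i < k" for i
      using that by (auto simp: hypercube_def PiE_iff)
    moreover have "b (i - k) \<in> {0, 1}" if "\<not> i < k" "i < k + p" for i
      using that \<open>b \<in> hypercube p\<close> by (auto simp: hypercube_def PiE_iff)
    ultimately show "(\<lambda>i. if i < k then c i else if i < k + p then b (i - k) else undefined)
        \<in> hypercube (k + p)"
      by (simp add: hypercube_def PiE_iff extensional_def)
  qed
qed (auto simp: hypercube_def PiE_iff extensional_def fun_eq_iff)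

text \<open>The inner sum consumes the variables below \<open>k\<close> and renumbers the rest, so
  the outer bits occupy the positions from \<open>k\<close> to \<open>k + p - 1\<close> of
  \<open>f\<close>.\<close>

lemma hypercube_sum_append:
  "(\<Sum>b\<in>hypercube p. subst_bits p b (\<Sum>c\<in>hypercube k. subst_bits k c f)) =
    (\<Sum>d\<in>hypercube (k + p). subst_bits (k + p) d f)"
proof -
  have "(\<Sum>d\<in>hypercube (k + p). subst_bits (k + p) d f) =
      (\<Sum>(c, b)\<in>hypercube k \<times> hypercube p. subst_bits p b (subst_bits k c f))"
    unfolding sum.reindex_bij_betw[OF bij_betw_hypercube_append, symmetric] subst_bits_def
    by (intro sum.cong) (auto simp: subst_subst fun_eq_iff intro!: arg_cong2[where f = subst])
  also have "\<dots> = (\<Sum>c\<in>hypercube k. \<Sum>b\<in>hypercube p. subst_bits p b (subst_bits k c f))"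
    by (simp add: sum.cartesian_product)
  also have "\<dots> = (\<Sum>b\<in>hypercube p. \<Sum>c\<in>hypercube k. subst_bits p b (subst_bits k c f))"
    by (rule sum.swap)
  finally show ?thesis
    by (simp add: subst_bits_def subst_sum)
qed


lemma hypercube_1_sum:
  "(\<Sum>b\<in>hypercube 1. F (b 0)) = F 0 + F (1 :: 'a::field)"
proof -
  let ?h = "\<lambda>c::'a. (\<lambda>_::nat. undefined)(0 := c)"
  have "hypercube 1 = ?h ` {0, 1}"
  proof (intro equalityI subsetI)
    fix b :: "nat \<Rightarrow> 'a" assume "b \<in> hypercube 1"
    then have "b = ?h (b 0)" "b 0 \<in> {0, 1}"
      by (auto simp: hypercube_def PiE_iff extensional_def)
    then show "b \<in> ?h ` {0, 1}"
      by blast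
  qed (auto simp: hypercube_def PiE_iff extensional_def)
  moreover have "inj_on ?h {0, 1}"
    by (auto simp: inj_on_def fun_eq_iff)
  ultimately have "(\<Sum>b\<in>hypercube 1. F (b 0)) = (\<Sum>c\<in>{0, 1}. F (?h c 0))"
    by (simp only: sum.reindex o_def)
  then show ?thesis
    by simp
qed

subsection \<open>Univariate forms: the separation\<close>

text \<open>
  Each factor depends on a single coordinate of \<open>(b, y\<^sub>0, y\<^sub>1)\<close>, so exchanging the values of
  \<open>y\<^sub>0\<close> between two points preserves the product of its values there. As the two points may
  differ in \<open>b\<close>, the identity survives summation over the hypercube.
\<close>

definition point :: "nat \<Rightarrow> (nat \<Rightarrow> 'a) \<Rightarrow> 'a \<Rightarrow> 'a \<Rightarrow> nat \<Rightarrow> 'a::field mpoly" where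
  "point p b y\<^sub>0 y\<^sub>1 i = (if i < p then Const (b i) else if i = p then Const y\<^sub>0
    else if i = Suc p then Const y\<^sub>1 else 0)"

lemma subst_subst_bits_point:
  "subst (point 0 c y\<^sub>0 y\<^sub>1) (subst_bits p b f) = subst (point p b y\<^sub>0 y\<^sub>1) f"
  unfolding subst_bits_def subst_subst
  by (rule arg_cong2[where f = subst]) (auto simp: point_def fun_eq_iff)

text \<open>If the form reads position \<open>p\<close>, the exchange swaps the two factors;
  otherwise it alters neither.\<close>

lemma affine_form_exchange:
  assumes "l \<in> affine_forms"
  shows "subst (point p b 0 0) l * subst (point p b' 1 1) l =
    subst (point p b 1 0) l * subst (point p b' 0 1) l"
  using assms by (auto simp: affine_forms_def point_def mult_ac)

lemma prod_list_exchange: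
  assumes "set ls \<subseteq> affine_forms"
  shows "subst (point p b 0 0) (prod_list ls) * subst (point p b' 1 1) (prod_list ls) =
    subst (point p b 1 0) (prod_list ls) * subst (point p b' 0 1) (prod_list ls)"
  using assms
proof (induction ls)
  case (Cons l ls)
  let ?P = "\<lambda>b y\<^sub>0 y\<^sub>1. subst (point p b y\<^sub>0 y\<^sub>1)"
  have "?P b 0 0 (prod_list (l # ls)) * ?P b' 1 1 (prod_list (l # ls)) =
      (?P b 0 0 l * ?P b' 1 1 l) * (?P b 0 0 (prod_list ls) * ?P b' 1 1 (prod_list ls))"
    by (simp add: mult_ac)
  also have "\<dots> = (?P b 1 0 l * ?P b' 0 1 l) * (?P b 1 0 (prod_list ls) * ?P b' 0 1 (prod_list ls))"
    using Cons by (simp add: affine_form_exchange)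
  finally show ?case
    by (simp add: mult_ac)
qed simp

lemma Var_sum_notin_VNP1_weak: "(\<lambda>_. Var 0 + Var 1) \<notin> (VNP1_weak :: (nat \<Rightarrow> 'a::field mpoly) set)"
proof
  assume "(\<lambda>_. Var 0 + Var 1) \<in> (VNP1_weak :: (nat \<Rightarrow> 'a mpoly) set)"
  then obtain g :: "nat \<Rightarrow> 'a mpoly" and p q :: "nat \<Rightarrow> nat" where g: "g \<in> VP1_weak"
    and sum: "\<And>n. Var 0 + Var 1 = (\<Sum>b\<in>hypercube (p n). subst_bits (p n) b (g (q n)))"
    unfolding VNP1_weak_def hypercube_sums_def by blast
  obtain ls where ls: "set ls \<subseteq> affine_forms" "g (q 0) = prod_list ls"
    using g unfolding VP1_weak_def VP1_over_def by blast
  define e :: "'a \<Rightarrow> 'a \<Rightarrow> 'a mpoly" where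
    "e y\<^sub>0 y\<^sub>1 = subst (point 0 (\<lambda>_. 0) y\<^sub>0 y\<^sub>1) (Var 0 + Var 1)" for y\<^sub>0 y\<^sub>1
  have e: "e y\<^sub>0 y\<^sub>1 = (\<Sum>b\<in>hypercube (p 0). subst (point (p 0) b y\<^sub>0 y\<^sub>1) (prod_list ls))" for y\<^sub>0 y\<^sub>1
    unfolding e_def sum[of 0] subst_sum subst_subst_bits_point ls(2) ..
  \<comment> \<open>Expanded, both sides are double sums over pairs \<open>(b, b')\<close> that
    agree term by term.\<close>
  have "e 0 0 * e 1 1 = e 1 0 * e 0 1"
    unfolding e sum_product by (intro sum.cong refl prod_list_exchange ls)
  moreover have "e y\<^sub>0 y\<^sub>1 = Const y\<^sub>0 + Const y\<^sub>1" for y\<^sub>0 y\<^sub>1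
    by (simp add: e_def point_def)
  \<comment> \<open>The identity now reads \<open>0 * (1 + 1) = 1 * 1\<close>.\<close>
  ultimately show False
    by simp
qed

subsection \<open>Products of affine forms as formulas\<close>

lemma affine_form_plus_formula:
  assumes "l \<in> affine_forms_plus"
  obtains \<phi> where "formula_size \<phi> = 9" "formula_poly \<phi> = l"
proof -
  obtain \<alpha> \<beta> \<gamma> i j where "l = Const \<alpha> * Var i + Const \<beta> * Var j + Const \<gamma>"
    using assms by (auto simp: affine_forms_plus_def)
  then show thesis
    by (intro that[of "FAdd (FAdd (FMul (FConst \<alpha>) (FVar i)) (FMul (FConst \<beta>) (FVar j)))
      (FConst \<gamma>)"]) simp_all
qed

text \<open>Each factor costs the 9 nodes of its form and one multiplication; the constant 1 that
  closes the product is the last node.\<close>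

lemma prod_list_formula:
  assumes "set ls \<subseteq> affine_forms_plus"
  shows "\<exists>\<phi>. formula_size \<phi> = 10 * length ls + 1 \<and> formula_poly \<phi> = prod_list ls"
  using assms
proof (induction ls)
  case Nil
  then show ?case
    by (intro exI[of _ "FConst 1"]) simp
next
  case (Cons l ls)
  then obtain \<phi> where \<phi>: "formula_size \<phi> = 10 * length ls + 1" "formula_poly \<phi> = prod_list ls"
    by auto
  obtain \<psi> where "formula_size \<psi> = 9" "formula_poly \<psi> = l"
    using Cons.prems by (auto elim: affine_form_plus_formula)
  with \<phi> show ?case
    by (intro exI[of _ "FMul \<psi> \<phi>"]) simp
qed

lemma VP1_weak_plus_subset_VP_e: "VP1_weak_plus \<subseteq> VP_e"
proof
  fix f :: "nat \<Rightarrow> 'a mpoly" assume "f \<in> VP1_weak_plus"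
  then obtain s where fam: "f \<in> families" and s: "p_bounded s"
    and ls: "\<And>n. \<exists>ls. length ls \<le> s n \<and> set ls \<subseteq> affine_forms_plus \<and> f n = prod_list ls"
    by (auto simp: VP1_weak_plus_def VP1_over_def)
  have "p_bounded (\<lambda>n. 10 * s n + 1)"
    by (intro p_bounded_add p_bounded_cmult p_bounded_const s)
  moreover have "\<exists>\<phi>. formula_size \<phi> \<le> 10 * s n + 1 \<and> formula_poly \<phi> = f n" for n
  proof -
    obtain ls where ls: "length ls \<le> s n" "set ls \<subseteq> affine_forms_plus" "f n = prod_list ls"
      using ls by blast
    obtain \<phi> where "formula_size \<phi> = 10 * length ls + 1" "formula_poly \<phi> = f n"
      using prod_list_formula ls by metis
    with ls(1) show ?thesis
      by (intro exI[of _ \<phi>]) simp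
  qed
  ultimately show "f \<in> VP_e"
    using fam unfolding VP_e_def by blast
qed

section \<open>Inclusion of the univariate class, and membership of the separating family\<close>

lemma affine_forms_subset_plus: "affine_forms \<subseteq> affine_forms_plus"
proof
  fix l :: "'a mpoly" assume "l \<in> affine_forms"
  then obtain \<alpha> \<beta> i where "l = Const \<alpha> * Var i + Const 0 * Var 0 + Const \<beta>"
    by (auto simp: affine_forms_def)
  then show "l \<in> affine_forms_plus"
    unfolding affine_forms_plus_def by blast
qed

lemma VP1_weak_subset_plus: "VP1_weak \<subseteq> VP1_weak_plus"
  unfolding VP1_weak_def VP1_weak_plus_def VP1_over_def using affine_forms_subset_plus by blast

lemma Var_sum_in_VNP1_weak_plus:
  "(\<lambda>_. Var 0 + Var 1) \<in> (VNP1_weak_plus :: (nat \<Rightarrow> 'a::field mpoly) set)"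
proof -
  let ?f = "Var 0 + Var 1 :: 'a mpoly"
  have "?f = Const 1 * Var 0 + Const 1 * Var 1 + Const 0"
    by simp
  then have "?f \<in> affine_forms_plus"
    unfolding affine_forms_plus_def by blast
  then have "\<exists>ls. length ls \<le> 1 \<and> set ls \<subseteq> affine_forms_plus \<and> ?f = prod_list ls"
    by (intro exI[of _ "[?f]"]) simp
  moreover have "(\<lambda>_. ?f) \<in> families"
    by (simp add: families_def p_bounded_const)
  ultimately have "(\<lambda>_. ?f) \<in> VP1_weak_plus"
    unfolding VP1_weak_plus_def VP1_over_def using p_bounded_const[of 1] by blast
  moreover have "VP1_weak_plus \<subseteq> (families :: (nat \<Rightarrow> 'a mpoly) set)"
    by (auto simp: VP1_weak_plus_def VP1_over_def)
  ultimately show ?thesis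
    unfolding VNP1_weak_plus_def using subset_hypercube_sums by blast
qed

subsection \<open>Hypercube sums of products of bivariate forms\<close>

text \<open>The analogue of \<open>VNP1_weak_plus\<close> for a single polynomial, with explicit
  costs: \<open>k\<close> bounds the number of bits and \<open>s\<close> the number of
  factors.\<close>

definition sum_of_products :: "nat \<Rightarrow> nat \<Rightarrow> 'a::field mpoly \<Rightarrow> bool" where
  "sum_of_products k s f \<longleftrightarrow> (\<exists>m ls. m \<le> k \<and> length ls \<le> s \<and> set ls \<subseteq> affine_forms_plus \<and>
    f = (\<Sum>b\<in>hypercube m. subst_bits m b (prod_list ls)))"

lemma sum_of_products_mono:
  "sum_of_products k s f \<Longrightarrow> k \<le> k' \<Longrightarrow> s \<le> s' \<Longrightarrow> sum_of_products k' s' f"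
  unfolding sum_of_products_def by (elim exE conjE) (intro exI conjI; (assumption | simp))

lemma sum_of_products_prod_list:
  assumes "set ls \<subseteq> affine_forms_plus"
  shows "sum_of_products 0 (length ls) (prod_list ls)"
  unfolding sum_of_products_def using assms
  by (intro exI[of _ 0] exI[of _ ls]) (simp add: hypercube_def subst_bits_def)

lemma sum_of_products_form: "l \<in> affine_forms_plus \<Longrightarrow> sum_of_products 0 1 l"
  using sum_of_products_prod_list[of "[l]"] by simp

lemma sum_of_products_hypercube_sum:
  assumes "sum_of_products k s f"
  shows "sum_of_products (k + p) s (\<Sum>b\<in>hypercube p. subst_bits p b f)"
proof -
  obtain m ls where m: "m \<le> k" "length ls \<le> s" "set ls \<subseteq> affine_forms_plus"
    and f: "f = (\<Sum>b\<in>hypercube m. subst_bits m b (prod_list ls))"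
    using assms by (auto simp: sum_of_products_def)
  then show ?thesis
    unfolding sum_of_products_def f hypercube_sum_append
    by (intro exI[of _ "m + p"] exI[of _ ls]) simp
qed

text \<open>Projections in the sense of Valiant; they keep a form affine in at most two
  variables.\<close>

definition projection :: "(nat \<Rightarrow> 'a::field mpoly) \<Rightarrow> bool" where
  "projection \<sigma> \<longleftrightarrow> range \<sigma> \<subseteq> range Var \<union> range Const"

lemma affine_forms_plusI:
  "f = Const \<alpha> * Var i + Const \<beta> * Var j + Const \<gamma> \<Longrightarrow> f \<in> affine_forms_plus"
  unfolding affine_forms_plus_def by blast

lemma projection_affine_form_plus:
  assumes "projection \<sigma>" "l \<in> affine_forms_plus"
  shows "subst \<sigma> l \<in> affine_forms_plus"
proof -
  obtain \<alpha> \<beta> \<gamma> i j where l: "l = Const \<alpha> * Var i + Const \<beta> * Var j + Const \<gamma>"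
    using assms by (auto simp: affine_forms_plus_def)
  have split: "\<exists>a k c. Const \<alpha> * \<sigma> i = Const a * Var k + Const c" for \<alpha> i
  proof -
    consider k where "\<sigma> i = Var k" | c where "\<sigma> i = Const c"
      using rangeI[of \<sigma> i] assms(1) unfolding projection_def by blast
    then show ?thesis
    proof cases
      case 1
      then show ?thesis
        by (intro exI[of _ \<alpha>] exI[of _ k] exI[of _ 0]) simp
    next
      case 2
      then show ?thesis
        by (intro exI[of _ 0] exI[of _ 0] exI[of _ "\<alpha> * c"]) (simp add: Const_mult)
    qed
  qed
  obtain a k c where 1: "Const \<alpha> * \<sigma> i = Const a * Var k + Const c"
    using split by blast
  obtain a' k' c' where 2: "Const \<beta> * \<sigma> j = Const a' * Var k' + Const c'"
    using split by blast
  have "subst \<sigma> l = Const a * Var k + Const a' * Var k' + Const (c + c' + \<gamma>)"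
    by (simp add: l 1 2 Const_add)
  then show ?thesis
    by (rule affine_forms_plusI)
qed

lemma sum_of_products_projection:
  assumes "sum_of_products k s f" "projection \<sigma>"
  shows "sum_of_products k s (subst \<sigma> f)"
proof -
  obtain m ls where m: "m \<le> k" "length ls \<le> s" "set ls \<subseteq> affine_forms_plus"
    and f: "f = (\<Sum>b\<in>hypercube m. subst_bits m b (prod_list ls))"
    using assms(1) by (auto simp: sum_of_products_def)
  \<comment> \<open>Inside the sum the \<open>m\<close> bits come first: \<open>\<tau>\<close> fixes
    them and applies \<open>\<sigma>\<close> to the remaining variables, with the images shifted
    past the bits.\<close>
  define \<tau> where "\<tau> i = (if i < m then Var i else subst (\<lambda>j. Var (j + m)) (\<sigma> (i - m)))" for i
  have "\<tau> i \<in> range Var \<union> range Const" for i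
  proof -
    have "\<sigma> (i - m) \<in> range Var \<union> range Const"
      using assms(2) by (auto simp: projection_def)
    then show ?thesis
      by (auto simp: \<tau>_def)
  qed
  then have "projection \<tau>"
    by (auto simp: projection_def)
  then have "set (map (subst \<tau>) ls) \<subseteq> affine_forms_plus"
    using m(3) projection_affine_form_plus by auto
  moreover have "subst \<sigma> (subst_bits m b g) = subst_bits m b (subst \<tau> g)" for b g
    unfolding subst_bits_def subst_subst
    by (rule arg_cong2[where f = subst]) (auto simp: \<tau>_def fun_eq_iff subst_subst)
  then have "subst \<sigma> f = (\<Sum>b\<in>hypercube m. subst_bits m b (prod_list (map (subst \<tau>) ls)))"
    by (simp add: f subst_sum flip: subst_prod_list)
  ultimately show ?thesis
    unfolding sum_of_products_def using m
    by (intro exI[of _ m] exI[of _ "map (subst \<tau>) ls"]) simp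
qed

lemma projection_shift: "projection (\<lambda>i. Var (i + k))"
  by (auto simp: projection_def)

lemma subst_bits_shift: "subst_bits k b (subst (\<lambda>i. Var (i + k)) f) = f"
  by (simp add: subst_bits_def subst_subst)

lemma sum_of_products_mult_prod_list:
  assumes "set ls \<subseteq> affine_forms_plus" "sum_of_products k s f"
  shows "sum_of_products k (length ls + s) (prod_list ls * f)"
proof -
  obtain m ms where m: "m \<le> k" "length ms \<le> s" "set ms \<subseteq> affine_forms_plus"
    and f: "f = (\<Sum>b\<in>hypercube m. subst_bits m b (prod_list ms))"
    using assms(2) by (auto simp: sum_of_products_def)
  define ls' where "ls' = map (subst (\<lambda>i. Var (i + m))) ls"
  have "set ls' \<subseteq> affine_forms_plus"
    using assms(1) projection_affine_form_plus[OF projection_shift] by (auto simp: ls'_def)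
  moreover have "subst_bits m b (prod_list ls') = prod_list ls" for b
    by (simp add: ls'_def subst_bits_shift flip: subst_prod_list)
  then have "prod_list ls * f = (\<Sum>b\<in>hypercube m. subst_bits m b (prod_list (ls' @ ms)))"
    by (simp add: f sum_distrib_left subst_bits_def)
  ultimately show ?thesis
    unfolding sum_of_products_def using m
    by (intro exI[of _ m] exI[of _ "ls' @ ms"]) (simp add: ls'_def)
qed

text \<open>Shifted past the bits of \<open>f\<close>, the factor \<open>g\<close> moves under the
  sum for \<open>f\<close>; the two nested sums then merge into one.\<close>

lemma sum_of_products_mult:
  assumes "sum_of_products k s f" "sum_of_products k' s' g"
  shows "sum_of_products (k + k') (s + s') (f * g)"
proof -
  obtain m ls where m: "m \<le> k" "length ls \<le> s" "set ls \<subseteq> affine_forms_plus"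
    and f: "f = (\<Sum>b\<in>hypercube m. subst_bits m b (prod_list ls))"
    using assms(1) by (auto simp: sum_of_products_def)
  define g' where "g' = subst (\<lambda>i. Var (i + m)) g"
  have "sum_of_products k' s' g'"
    unfolding g'_def using assms(2) projection_shift by (rule sum_of_products_projection)
  then have "sum_of_products (k' + m) (length ls + s')
      (\<Sum>b\<in>hypercube m. subst_bits m b (prod_list ls * g'))"
    by (intro sum_of_products_hypercube_sum sum_of_products_mult_prod_list m)
  moreover have "subst_bits m b g' = g" for b
    by (simp add: g'_def subst_bits_shift)
  then have "(\<Sum>b\<in>hypercube m. subst_bits m b (prod_list ls * g')) = f * g"
    by (simp add: f sum_distrib_right subst_bits_def)
  ultimately show ?thesis
    using m by (auto elim!: sum_of_products_mono)
qed

subsection \<open>Simulation of formulas\<close>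

text \<open>Variable 0 plays the role of a bound variable in de Bruijn style, so that nested bit
  sums always bind the lowest variable.\<close>

definition plug :: "'a::field \<Rightarrow> 'a mpoly \<Rightarrow> 'a mpoly" where
  "plug c = subst (case_nat (Const c) Var)"

lemma plug_simps [simp]:
  "plug c (f + g) = plug c f + plug c g"
  "plug c (f - g) = plug c f - plug c g"
  "plug c (- f) = - plug c f"
  "plug c (f * g) = plug c f * plug c g"
  "plug c (Const d) = Const d"
  "plug c 0 = 0"
  "plug c 1 = 1"
  "plug c (numeral w) = numeral w"
  "plug c (Var 0) = Const c"
  "plug c (Var (Suc i)) = Var i"
  by (simp_all add: plug_def flip: Const_numeral)

lemma sum_of_products_plug: "sum_of_products k s f \<Longrightarrow> sum_of_products k s (plug c f)"
  unfolding plug_def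
  by (erule sum_of_products_projection) (auto simp: projection_def split: nat.splits)

definition bit_sum :: "'a::field mpoly \<Rightarrow> 'a mpoly" where
  "bit_sum f = plug 0 f + plug 1 f"

lemma bit_sum_eq: "bit_sum f = (\<Sum>b\<in>hypercube 1. subst_bits 1 b f)"
proof -
  have "subst_bits 1 b f = plug (b 0) f" for b
    unfolding subst_bits_def plug_def
    by (rule arg_cong2[where f = subst]) (auto simp: fun_eq_iff split: nat.splits)
  then show ?thesis
    using hypercube_1_sum[of "\<lambda>c. plug c f"] by (simp add: bit_sum_def)
qed

lemma sum_of_products_bit_sum:
  "sum_of_products k s f \<Longrightarrow> sum_of_products (Suc k) s (bit_sum f)"
  using sum_of_products_hypercube_sum[of k s f 1] by (simp add: bit_sum_eq)

text \<open>The division by \<open>2\<close> is where the characteristic matters.\<close>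

definition nand :: "'a::field mpoly \<Rightarrow> 'a mpoly \<Rightarrow> 'a mpoly" where
  "nand f g = (1 - Const (1/2) * f - Const (1/2) * g) * ((1 + f) * (1 + g))"

lemma plug_nand [simp]: "plug c (nand f g) = nand (plug c f) (plug c g)"
  by (simp add: nand_def)

text \<open>With zero, one or two arguments equal to 1, the first factor is \<open>1\<close>,
  \<open>1/2\<close>, \<open>0\<close> and the other two multiply to \<open>1\<close>,
  \<open>2\<close>, \<open>4\<close>.\<close>

lemma nand_bits:
  assumes "CHAR('a::field) \<noteq> 2"
  shows "nand 0 0 = (1 :: 'a mpoly)" "nand 0 1 = (1 :: 'a mpoly)" "nand 1 0 = (1 :: 'a mpoly)"
    "nand 1 1 = (0 :: 'a mpoly)"
proof -
  have "(2 :: 'a) \<noteq> 0"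
  proof
    assume "(2 :: 'a) = 0"
    then have "CHAR('a) dvd 2"
      using of_nat_eq_0_iff_char_dvd[where 'a = 'a, of 2] by simp
    then have "CHAR('a) = 1 \<or> CHAR('a) = 2"
      using prime_nat_iff two_is_prime_nat by blast
    with assms show False
      by simp
  qed
  then have "1/2 + 1/2 = (1 :: 'a)"
    by simp
  then have "Const (1/2) + Const (1/2) = (1 :: 'a mpoly)"
    by (metis Const_1 Const_add)
  then have half: "2 * Const (1/2) = (1 :: 'a mpoly)"
    unfolding mult_2 .
  then have "1 - Const (1/2) - Const (1/2) = (0 :: 'a mpoly)"
    by (metis cancel_comm_monoid_add_class.diff_cancel diff_diff_eq mult_2)
  moreover have "(1 - Const (1/2)) * 2 = (1 :: 'a mpoly)"
    using half by (simp add: left_diff_distrib mult.commute)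
  ultimately show "nand 0 0 = (1 :: 'a mpoly)" "nand 0 1 = (1 :: 'a mpoly)" "nand 1 0 = (1 :: 'a mpoly)"
    "nand 1 1 = (0 :: 'a mpoly)"
    by (simp_all add: nand_def)
qed

lemma Var_affine_form: "Var i \<in> affine_forms"
proof -
  have "Var i = Const 1 * Var i + Const 0"
    by simp
  then show ?thesis
    unfolding affine_forms_def by blast
qed

lemma negated_Var_affine_form: "1 - Var i \<in> affine_forms"
proof -
  have "1 - Var i = Const (- 1) * Var i + Const 1"
    by simp
  then show ?thesis
    unfolding affine_forms_def by blast
qed

lemma sum_of_products_nand:
  assumes "f \<in> affine_forms" "g \<in> affine_forms"
  shows "sum_of_products 0 3 (nand f g)"
proof -
  obtain \<alpha> \<beta> i \<alpha>' \<beta>' j where f: "f = Const \<alpha> * Var i + Const \<beta>"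
    and g: "g = Const \<alpha>' * Var j + Const \<beta>'"
    using assms by (auto simp: affine_forms_def)
  have "1 - Const (1/2) * f - Const (1/2) * g =
      Const (- (1/2) * \<alpha>) * Var i + Const (- (1/2) * \<alpha>') * Var j +
      Const (1 + - (1/2) * \<beta> + - (1/2) * \<beta>')"
    unfolding Const_mult Const_add Const_uminus by (simp add: f g algebra_simps)
  moreover have "1 + f = Const \<alpha> * Var i + Const 0 * Var 0 + Const (1 + \<beta>)"
    "1 + g = Const \<alpha>' * Var j + Const 0 * Var 0 + Const (1 + \<beta>')"
    by (simp_all add: f g Const_add)
  ultimately have "set [1 - Const (1/2) * f - Const (1/2) * g, 1 + f, 1 + g] \<subseteq> affine_forms_plus"
    using affine_forms_plusI by (metis empty_set empty_subsetI insert_subset list.simps(15))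
  from sum_of_products_prod_list[OF this] show ?thesis
    by (simp add: nand_def numeral_3_eq_3)
qed

text \<open>For a bit \<open>b\<close> this is \<open>(-1)^b\<close> written as an affine
  form.\<close>

definition sign :: "'a::field mpoly \<Rightarrow> 'a mpoly" where
  "sign f = 1 - 2 * f"

lemma plug_sign [simp]: "plug c (sign f) = sign (plug c f)"
  by (simp add: sign_def)

lemma sign_bits: "sign 0 = 1" "sign 1 = -1"
  by (simp_all add: sign_def)

lemma sum_of_products_sign: "sum_of_products 0 1 (sign (Var i))"
proof (rule sum_of_products_form[OF affine_forms_plusI])
  show "sign (Var i) = Const (- 2) * Var i + Const 0 * Var 0 + Const 1"
    by (simp add: sign_def)
qed

text \<open>
  The candidate \<open>1 + e * (f - 1)\<close> is not multiplicative in \<open>f\<close> as a polynomial, only at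
  \<open>e \<in> {0, 1}\<close>; hence only these two restrictions are prescribed.
\<close>

definition switch :: "'a::field mpoly \<Rightarrow> 'a mpoly \<Rightarrow> bool" where
  "switch E f \<longleftrightarrow> plug 0 E = 1 \<and> plug 1 E = f"

text \<open>Let \<open>b\<close> be the summed bit. At \<open>e = 0\<close> it is free, and the
  signed sum of \<open>f + b\<close> collapses to \<open>(f + 1) - f = 1\<close>. At
  \<open>e = 1\<close> the clause forces \<open>b = 0\<close>, and the sign of \<open>e\<close>
  cancels the constant \<open>-1\<close>, leaving \<open>f\<close>.\<close>

lemma switch_leaf:
  fixes f :: "'a::field mpoly"
  assumes char: "CHAR('a) \<noteq> 2"
  assumes f: "f = Const \<alpha> * Var i + Const \<beta>"
  shows "\<exists>E. sum_of_products 1 6 E \<and> switch E f"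
proof -
  \<comment> \<open>Under the sum, \<open>Var 0\<close> is the summed bit, \<open>Var 1\<close> is
    \<open>e\<close>, and the variables of \<open>f\<close> start at index 2.\<close>
  define l :: "'a mpoly" where "l = Const \<alpha> * Var (Suc (Suc i)) + Const 1 * Var 0 + Const \<beta>"
  define E where "E = bit_sum (nand (Var 0) (Var 1) * (sign (Var 0) * (sign (Var 1) * (Const (- 1) * l))))"
  have "Const (- 1) * l = Const (- \<alpha>) * Var (Suc (Suc i)) + Const (- 1) * Var 0 + Const (- \<beta>)"
    by (simp add: l_def)
  then have "sum_of_products 0 1 (Const (- 1) * l)"
    by (intro sum_of_products_form affine_forms_plusI)
  then have "sum_of_products (Suc (0 + (0 + (0 + 0)))) (3 + (1 + (1 + 1))) E"
    unfolding E_def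
    by (intro sum_of_products_bit_sum sum_of_products_mult sum_of_products_nand
      sum_of_products_sign Var_affine_form)
  moreover have "switch E f"
    by (simp add: switch_def E_def bit_sum_def l_def f sign_bits nand_bits[OF char])
  ultimately show ?thesis
    by (auto simp: numeral_eq_Suc)
qed

lemma switch_mult:
  assumes "switch E f" "switch E' f'"
  shows "switch (E * E') (f * f')"
  using assms by (simp add: switch_def)

text \<open>
  The bits \<open>l, r\<close> switch the two summands. The implications to \<open>e\<close> and the exclusion of
  \<open>l = r = 1\<close> leave \<open>(e, l, r) = (1, 0, 0)\<close> as the only configuration with
  \<open>e \<noteq> l + r\<close>; the bit \<open>c\<close> is free there and \<open>0\<close> elsewhere, so its sign removes it.
\<close>

lemma switch_add:
  fixes f f' :: "'a::field mpoly"
  assumes char: "CHAR('a) \<noteq> 2"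
  assumes E: "sum_of_products k s E" "switch E f"
  assumes E': "sum_of_products k' s' E'" "switch E' f'"
  shows "\<exists>F. sum_of_products (k + k' + 3) (s + s' + 19) F \<and> switch F (f + f')"
proof -
  \<comment> \<open>The indices follow the order of binding: the three sums remove \<open>c\<close>,
    \<open>r\<close>, \<open>l\<close> in turn, which leaves \<open>e\<close> as variable 0 of
    \<open>F\<close>.\<close>
  define c r l e :: "'a mpoly"
    where "c = Var 0" and "r = Var (Suc 0)" and "l = Var (Suc (Suc 0))" and "e = Var (Suc (Suc (Suc 0)))"
  \<comment> \<open>The switching bit of a summand is replaced by \<open>v\<close>; its other
    variables skip the four bits, of which \<open>e\<close> is already counted once.\<close>
  define shift where "shift v = case_nat v (\<lambda>i. Var (Suc (Suc (Suc (Suc i)))))"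
    for v :: "'a mpoly"
  define G where "G = nand l r * (nand l (1 - e) * (nand r (1 - e) *
    (nand c (1 - e) * (nand c l * (nand c r * (sign c * (subst (shift l) E * subst (shift r) E')))))))"
  define F where "F = bit_sum (bit_sum (bit_sum G))"
  have proj: "projection (shift (Var i))" for i
    by (auto simp: projection_def shift_def split: nat.splits)
  \<comment> \<open>Six clauses of three factors each and one sign make up the 19 additional
    factors.\<close>
  have "sum_of_products (Suc (Suc (Suc (0 + (0 + (0 + (0 + (0 + (0 + (0 + (k + k')))))))))))
      (3 + (3 + (3 + (3 + (3 + (3 + (1 + (s + s')))))))) F"
    unfolding F_def G_def c_def r_def l_def e_def
    by (intro sum_of_products_bit_sum sum_of_products_mult sum_of_products_nand sum_of_products_sign
      sum_of_products_projection E(1) E'(1) proj Var_affine_form negated_Var_affine_form)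
  then have "sum_of_products (k + k' + 3) (s + s' + 19) F"
    by (rule sum_of_products_mono) simp_all
  \<comment> \<open>Once all four bits are fixed, each summand sees only the bit that switches
    it.\<close>
  moreover have plug_E: "plug e\<^sub>0 (plug l\<^sub>0 (plug r\<^sub>0 (plug c\<^sub>0 (subst (shift l) H)))) = plug l\<^sub>0 H"
      "plug e\<^sub>0 (plug l\<^sub>0 (plug r\<^sub>0 (plug c\<^sub>0 (subst (shift r) H)))) = plug r\<^sub>0 H"
      for e\<^sub>0 l\<^sub>0 r\<^sub>0 c\<^sub>0 H
    unfolding plug_def subst_subst
    by (rule arg_cong2[where f = subst];
        auto simp: fun_eq_iff shift_def l_def r_def split: nat.splits)+
  have "switch F (f + f')"
    using E(2) E'(2)
    by (simp add: switch_def F_def bit_sum_def G_def plug_E)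
      (simp add: c_def r_def l_def e_def sign_bits nand_bits[OF char])
  ultimately show ?thesis
    by blast
qed

text \<open>Addition is the most expensive node, with 3 new bits and 19 new factors; charging this
  to every node keeps the bounds linear in the size.\<close>

lemma formula_switch:
  assumes char: "CHAR('a::field) \<noteq> 2"
  shows "\<exists>E. sum_of_products (3 * formula_size \<phi>) (19 * formula_size \<phi>) E \<and>
    switch E (formula_poly \<phi> :: 'a mpoly)"
proof (induction \<phi>)
  case (FVar i)
  have "formula_poly (FVar i) = Const 1 * Var i + Const (0 :: 'a)"
    by simp
  from switch_leaf[OF char this] obtain E :: "'a mpoly"
    where "sum_of_products 1 6 E" "switch E (formula_poly (FVar i))"
    by blast
  then show ?case
    by (intro exI[of _ E] conjI) (simp_all add: sum_of_products_mono)
next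
  case (FConst c)
  have "formula_poly (FConst c) = Const 0 * Var 0 + Const (c :: 'a)"
    by simp
  from switch_leaf[OF char this] obtain E :: "'a mpoly"
    where "sum_of_products 1 6 E" "switch E (formula_poly (FConst c))"
    by blast
  then show ?case
    by (intro exI[of _ E] conjI) (simp_all add: sum_of_products_mono)
next
  case (FAdd \<phi> \<psi>)
  then obtain E E' where
    "sum_of_products (3 * formula_size \<phi>) (19 * formula_size \<phi>) E" "switch E (formula_poly \<phi>)"
    "sum_of_products (3 * formula_size \<psi>) (19 * formula_size \<psi>) E'" "switch E' (formula_poly \<psi>)"
    by blast
  from switch_add[OF char this] show ?case
    by (simp add: algebra_simps)
next
  case (FMul \<phi> \<psi>)
  then obtain E E' where E:
    "sum_of_products (3 * formula_size \<phi>) (19 * formula_size \<phi>) E" "switch E (formula_poly \<phi>)"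
    "sum_of_products (3 * formula_size \<psi>) (19 * formula_size \<psi>) E'" "switch E' (formula_poly \<psi>)"
    by blast
  have "sum_of_products (3 * formula_size (FMul \<phi> \<psi>)) (19 * formula_size (FMul \<phi> \<psi>)) (E * E')"
    by (rule sum_of_products_mono[OF sum_of_products_mult[OF E(1,3)]]) simp_all
  with switch_mult[OF E(2,4)] show ?case
    by auto
qed

text \<open>Setting the bit \<open>e\<close> of the switch to 1 is a projection and costs neither
  bits nor factors.\<close>

lemma formula_sum_of_products:
  assumes "CHAR('a::field) \<noteq> 2"
  shows "sum_of_products (3 * formula_size \<phi>) (19 * formula_size \<phi>) (formula_poly \<phi> :: 'a mpoly)"
  using formula_switch[OF assms, of \<phi>] sum_of_products_plug unfolding switch_def by metis

section \<open>From single polynomials to families\<close>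

lemma sum_of_products_VNP1_weak_plus:
  assumes "f \<in> families" "p_bounded k" "p_bounded s" "\<And>n. sum_of_products (k n) (s n) (f n)"
  shows "f \<in> VNP1_weak_plus"
proof -
  obtain m ls where m: "\<And>n. m n \<le> k n" and ls: "\<And>n. length (ls n) \<le> s n"
    "\<And>n. set (ls n) \<subseteq> affine_forms_plus"
    and f: "\<And>n. f n = (\<Sum>b\<in>hypercube (m n). subst_bits (m n) b (prod_list (ls n)))"
    using assms(4) unfolding sum_of_products_def by metis
  define g where "g n = prod_list (ls n)" for n
  have "card (vars (g n)) \<le> 2 * s n" for n
    using card_vars_prod_list[OF ls(2)[of n]] ls(1)[of n] by (simp add: g_def)
  then have "g \<in> families"
    unfolding families_def by (blast intro: p_bounded_mono p_bounded_cmult assms(3))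
  then have "g \<in> VP1_weak_plus"
    using assms(3) ls unfolding VP1_weak_plus_def VP1_over_def g_def by blast
  moreover have "p_bounded m"
    using assms(2) m by (rule p_bounded_mono)
  ultimately show ?thesis
    unfolding VNP1_weak_plus_def hypercube_sums_def using assms(1) f p_bounded_ident
    unfolding g_def by fast
qed

lemma VNP_subset_VNP1_weak_plus:
  assumes "CHAR('a::field) \<noteq> 2"
  shows "VNP \<subseteq> (VNP1_weak_plus :: (nat \<Rightarrow> 'a mpoly) set)"
proof
  fix f :: "nat \<Rightarrow> 'a mpoly" assume "f \<in> VNP"
  then obtain g p q where fam: "f \<in> families" and g: "g \<in> VP_e" and pq: "p_bounded p" "p_bounded q"
    and f: "\<And>n. f n = (\<Sum>b\<in>hypercube (p n). subst_bits (p n) b (g (q n)))"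
    unfolding VNP_def hypercube_sums_def by blast
  obtain s where s: "p_bounded s"
    and \<phi>: "\<And>n. \<exists>\<phi>. formula_size \<phi> \<le> s n \<and> formula_poly \<phi> = g n"
    using g by (auto simp: VP_e_def)
  have "sum_of_products (3 * s n) (19 * s n) (g n)" for n
    using \<phi>[of n] formula_sum_of_products[OF assms]
    by (metis mult_le_mono2 sum_of_products_mono)
  \<comment> \<open>The bits simulating the formula merge with the \<open>p n\<close> bits of the
    given sum.\<close>
  then have "sum_of_products (3 * s (q n) + p n) (19 * s (q n)) (f n)" for n
    unfolding f by (rule sum_of_products_hypercube_sum)
  then show "f \<in> VNP1_weak_plus"
    by (rule sum_of_products_VNP1_weak_plus[OF fam, rotated -1])
      (intro p_bounded_add p_bounded_cmult p_bounded_compose[OF s] pq)+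
qed

theorem theorem6p2:
  assumes "CHAR('a::field) \<noteq> 2"
  shows "(VNP1_weak :: (nat \<Rightarrow> 'a mpoly) set) \<subset> VNP1_weak_plus \<and>
    (VNP1_weak_plus :: (nat \<Rightarrow> 'a mpoly) set) = VNP"
proof
  have "VNP1_weak \<subseteq> (VNP1_weak_plus :: (nat \<Rightarrow> 'a mpoly) set)"
    unfolding VNP1_weak_def VNP1_weak_plus_def by (intro hypercube_sums_mono VP1_weak_subset_plus)
  then show "(VNP1_weak :: (nat \<Rightarrow> 'a mpoly) set) \<subset> VNP1_weak_plus"
    using Var_sum_notin_VNP1_weak Var_sum_in_VNP1_weak_plus by blast
  have "VNP1_weak_plus \<subseteq> (VNP :: (nat \<Rightarrow> 'a mpoly) set)"
    unfolding VNP_def VNP1_weak_plus_def by (intro hypercube_sums_mono VP1_weak_plus_subset_VP_e)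
  then show "(VNP1_weak_plus :: (nat \<Rightarrow> 'a mpoly) set) = VNP"
    using VNP_subset_VNP1_weak_plus[OF assms] by blast
qed

end
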